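(* Let $B$ be a nucleation process and $G$ a growth process on $[t_0,T]$, let $t\in[t_0,T]$ and let $\Pi=(t_i)_{i=0}^n$ be a partition of $[t_0,t]$. Then both $s_\Pi(t)$ and $S_\Pi(t)$ are random closed sets.
   Context: Setting. $\mathfrak X$ is a reflexive Banach space with separable dual; $[t_0,T]\subset\mathbb R$; $(\Omega,\mathfrak F,\{\mathfrak F_t\}_{t\in[t_0,T]},\mathbb P)$ is a filtered complete probability space satisfying the usual conditions. $\mathbb F(\mathfrak X)$ is the family of non-empty closed subsets of $\mathfrak X$. A set-valued map $X$ defined on a measurable space $(E,\mathcal E)$ with values in subsets of $\mathfrak X$ is measurable if $\{e: X(e)\cap O\neq\emptyset\}\in\mathcal E$ for every open $O\subseteq\mathfrak X$. A random closed set is a measurable map $\Omega\to\mathbb F(\mathfrak X)$ with respect to $\mathfrak F$. Nucleation process: a map $B:\Omega\times[t_0,T]\to\mathbb F(\mathfrak X)$, $B_t=B(\cdot,t)$, such that $B_t$ is $\mathfrak F_t$-measurable for every $t$, and $B_s\subseteq B_t$ whenever $s<t$. Growth process: a map $G:\Omega\times[t_0,T]\to\mathbb F(\mathfrak X)$ such that for all $(\omega,t)$: $0\in G(\omega,t)$, $G(\omega,t)$ is convex, $G(\omega,t)\subseteq K$ for a fixed non-empty closed bounded set $K\subset\mathfrak X$ (independent of $\omega,t$), and $G$ is measurable with respect to the predictable $\sigma$-algebra $\mathcal P$ on $\Omega\times[t_0,T]$, i.e. the $\sigma$-algebra generated by the sets $A\times\{t_0\}$ with $A\in\mathfrak F_{t_0}$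 and $A\times(s,t]$ with $A\in\mathfrak F_s$, $(s,t]\subset[t_0,T]$. For $a\le b$, $\int_a^b G(\tau)\,d\tau$ is the random set $\omega\mapsto\int_a^bG(\omega,\tau)\,d\tau$, the Aumann integral with respect to Lebesgue measure: $\{\int_a^b g(\tau)\,d\tau: g \text{ Bochner integrable on }[t_0,T],\ g(\tau)\in G(\omega,\tau)\text{ for a.e. }\tau\}$. Minkowski sum: $A+C=\{a+c:a\in A,c\in C\}$ (with $\emptyset+A=\emptyset$), and $A\oplus C=\overline{A+C}$. A partition of $[t_0,t]$ is $\Pi=(t_i)_{i=0}^n$ with $t_0<t_1<\dots<t_n=t$. Put $\Delta B_{t_i}=B_{t_i}\setminus B_{t_{i-1}}^{o}$, where $B^{o}$ is the interior of $B$, and $$s_\Pi(t)=\Big(B_{t_0}\oplus\int_{t_0}^tG(\tau)d\tau\Big)\cup\bigcup_{i=1}^n\Big(\Delta B_{t_i}\oplus\int_{t_i}^tG(\tau)d\tau\Big),$$ $$S_\Pi(t)=\Big(B_{t_0}\oplus\int_{t_0}^tG(\tau)d\tau\Big)\cup\bigcup_{i=1}^n\Big(\Delta B_{t_i}\oplus\int_{t_{i-1}}^tG(\tau)d\tau\Big).$$ *)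

theory Defs
  imports "HOL-Probability.Probability"
begin

definition reflexive_space :: "'a::real_normed_vector itself \<Rightarrow> bool" where
  "reflexive_space X \<longleftrightarrow>
     (\<forall>\<phi> :: ('a \<Rightarrow>\<^sub>L real) \<Rightarrow>\<^sub>L real. \<exists>x::'a. \<forall>f. blinfun_apply \<phi> f = blinfun_apply f x)"

definition separable_dual :: "'a::real_normed_vector itself \<Rightarrow> bool" where
  "separable_dual X \<longleftrightarrow> separable_space (euclidean :: ('a \<Rightarrow>\<^sub>L real) topology)"

(* The filtration is indexed by [t0, T]; the values of F outside this interval are irrelevant. *)
locale filtered_complete_prob_space = prob_space M + complete_measure M
  for M :: "'w measure" +
  fixes F :: "real \<Rightarrow> 'w measure" and t0 T :: real
  assumes subalg: "t \<in> {t0..T} \<Longrightarrow> subalgebra M (F t)"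
    and filtration_mono: "s \<in> {t0..T} \<Longrightarrow> t \<in> {t0..T} \<Longrightarrow> s \<le> t \<Longrightarrow> sets (F s) \<subseteq> sets (F t)"
    and null_sets_initial: "null_sets M \<subseteq> sets (F t0)"
    and right_continuous: "t \<in> {t0..<T} \<Longrightarrow> sets (F t) = (\<Inter>s\<in>{t<..T}. sets (F s))"

definition predictable_sigma :: "'w measure \<Rightarrow> (real \<Rightarrow> 'w measure) \<Rightarrow> real \<Rightarrow> real \<Rightarrow> ('w \<times> real) measure" where
  "predictable_sigma M F t0 T = sigma (space M \<times> {t0..T})
     ({A \<times> {t0} | A. A \<in> sets (F t0)} \<union>
      {A \<times> {s<..t} | A s t. t0 \<le> s \<and> s < t \<and> t \<le> T \<and> A \<in> sets (F s)})"

(* Only the measurable-space part (space and sets) of the first argument is used. *)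
definition set_valued_measurable :: "'e measure \<Rightarrow> ('e \<Rightarrow> 'a::topological_space set) \<Rightarrow> bool" where
  "set_valued_measurable E X \<longleftrightarrow> (\<forall>U. open U \<longrightarrow> {e \<in> space E. X e \<inter> U \<noteq> {}} \<in> sets E)"

definition random_closed_set :: "'w measure \<Rightarrow> ('w \<Rightarrow> 'a::topological_space set) \<Rightarrow> bool" where
  "random_closed_set M X \<longleftrightarrow>
     (\<forall>\<omega>\<in>space M. X \<omega> \<noteq> {} \<and> closed (X \<omega>)) \<and> set_valued_measurable M X"

definition nucleation_process ::
  "'w measure \<Rightarrow> (real \<Rightarrow> 'w measure) \<Rightarrow> real \<Rightarrow> real \<Rightarrow> ('w \<Rightarrow> real \<Rightarrow> 'a::topological_space set) \<Rightarrow> bool" where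
  "nucleation_process M F t0 T B \<longleftrightarrow>
     (\<forall>\<omega>\<in>space M. \<forall>t\<in>{t0..T}. B \<omega> t \<noteq> {} \<and> closed (B \<omega> t)) \<and>
     (\<forall>t\<in>{t0..T}. set_valued_measurable (F t) (\<lambda>\<omega>. B \<omega> t)) \<and>
     (\<forall>\<omega>\<in>space M. \<forall>s\<in>{t0..T}. \<forall>t\<in>{t0..T}. s < t \<longrightarrow> B \<omega> s \<subseteq> B \<omega> t)"

definition growth_process ::
  "'w measure \<Rightarrow> (real \<Rightarrow> 'w measure) \<Rightarrow> real \<Rightarrow> real \<Rightarrow> ('w \<Rightarrow> real \<Rightarrow> 'a::real_normed_vector set) \<Rightarrow> bool" where
  "growth_process M F t0 T G \<longleftrightarrow>
     (\<forall>\<omega>\<in>space M. \<forall>t\<in>{t0..T}. G \<omega> t \<noteq> {} \<and> closed (G \<omega> t) \<and> 0 \<in> G \<omega> t \<and> convex (G \<omega> t)) \<and>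
     (\<exists>K. K \<noteq> {} \<and> closed K \<and> bounded K \<and> (\<forall>\<omega>\<in>space M. \<forall>t\<in>{t0..T}. G \<omega> t \<subseteq> K)) \<and>
     set_valued_measurable (predictable_sigma M F t0 T) (\<lambda>(\<omega>, t). G \<omega> t)"

(* Integrals over [a, b] of the selections that are Bochner integrable on all of [t0, T]. The sort
   second_countable_topology is required by the Bochner integral of HOL-Analysis; it is no
   restriction for spaces with separable dual, which are themselves separable. *)
definition aumann_integral ::
  "real \<Rightarrow> real \<Rightarrow> (real \<Rightarrow> 'a::{banach, second_countable_topology} set) \<Rightarrow> real \<Rightarrow> real \<Rightarrow> 'a set" where
  "aumann_integral t0 T H a b =
     {set_lebesgue_integral lebesgue {a..b} g | g.
        set_integrable lebesgue {t0..T} g \<and> (AE \<tau> in lebesgue. \<tau> \<in> {t0..T} \<longrightarrow> g \<tau> \<in> H \<tau>)}"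

(* The + on sets is the elementwise (Minkowski) sum of HOL-Library.Set_Algebras. *)
definition closed_minkowski_sum :: "'a::real_normed_vector set \<Rightarrow> 'a set \<Rightarrow> 'a set" where
  "closed_minkowski_sum A C = closure (A + C)"

(* The points are p 0, ..., p n; n = 0 occurs exactly when t = t0. *)
definition is_partition :: "real \<Rightarrow> real \<Rightarrow> nat \<Rightarrow> (nat \<Rightarrow> real) \<Rightarrow> bool" where
  "is_partition t0 t n p \<longleftrightarrow> p 0 = t0 \<and> p n = t \<and> (\<forall>i<n. p i < p (Suc i))"

definition nucleation_increment :: "(real \<Rightarrow> 'a::topological_space set) \<Rightarrow> (nat \<Rightarrow> real) \<Rightarrow> nat \<Rightarrow> 'a set" where
  "nucleation_increment C p i = C (p i) - interior (C (p (i - 1)))"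

definition lower_growth_sum ::
  "real \<Rightarrow> real \<Rightarrow> ('w \<Rightarrow> real \<Rightarrow> 'a::{banach, second_countable_topology} set) \<Rightarrow> ('w \<Rightarrow> real \<Rightarrow> 'a set) \<Rightarrow>
    nat \<Rightarrow> (nat \<Rightarrow> real) \<Rightarrow> real \<Rightarrow> 'w \<Rightarrow> 'a set" where
  "lower_growth_sum t0 T B G n p t \<omega> =
     closed_minkowski_sum (B \<omega> t0) (aumann_integral t0 T (G \<omega>) t0 t) \<union>
     (\<Union>i\<in>{1..n}. closed_minkowski_sum (nucleation_increment (B \<omega>) p i)
                     (aumann_integral t0 T (G \<omega>) (p i) t))"

definition upper_growth_sum ::
  "real \<Rightarrow> real \<Rightarrow> ('w \<Rightarrow> real \<Rightarrow> 'a::{banach, second_countable_topology} set) \<Rightarrow> ('w \<Rightarrow> real \<Rightarrow> 'a set) \<Rightarrow>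
    nat \<Rightarrow> (nat \<Rightarrow> real) \<Rightarrow> real \<Rightarrow> 'w \<Rightarrow> 'a set" where
  "upper_growth_sum t0 T B G n p t \<omega> =
     closed_minkowski_sum (B \<omega> t0) (aumann_integral t0 T (G \<omega>) t0 t) \<union>
     (\<Union>i\<in>{1..n}. closed_minkowski_sum (nucleation_increment (B \<omega>) p i)
                     (aumann_integral t0 T (G \<omega>) (p (i - 1)) t))"

end

theory Submission
  imports Defs
begin

text \<open>Effros measurability passes to closures, countable unions and Minkowski sums by testing on a
  countable base. The increment \<open>B\<^sub>t - interior B\<^sub>s\<close> is handled through the connectedness of balls,
  and the Aumann integral through a Castaing representation \<open>c\<^sub>0, c\<^sub>1, \<dots>\<close> of \<open>G\<close>: every integrable
  selection is uniformly close to some \<open>\<tau> \<mapsto> c\<^bsub>N \<tau>\<^esub>(\<omega>, \<tau>)\<close> with measurable \<open>N\<close>, and \<open>N\<close> is an a.e.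
  limit of step functions from a countable family that does not depend on \<open>\<omega>\<close>. So the integral meets
  an open set iff one of countably many measurable functions of \<open>\<omega>\<close>, namely the integrals along these
  step functions, takes a value in it.\<close>

section \<open>Effros measurability of set-valued maps\<close>

lemma set_valued_measurableD:
  "set_valued_measurable E X \<Longrightarrow> open U \<Longrightarrow> {e \<in> space E. X e \<inter> U \<noteq> {}} \<in> sets E"
  by (simp add: set_valued_measurable_def)

lemma set_valued_measurable_mono:
  assumes "set_valued_measurable E X" "space E = space E'" "sets E \<subseteq> sets E'"
  shows "set_valued_measurable E' X"
  using assms by (auto simp: set_valued_measurable_def)

lemma set_valued_measurable_closure:
  fixes X :: "'e \<Rightarrow> 'a::topological_space set"
  assumes "set_valued_measurable E X"
  shows "set_valued_measurable E (\<lambda>e. closure (X e))"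
proof -
  have "closure A \<inter> U \<noteq> {} \<longleftrightarrow> A \<inter> U \<noteq> {}" if "open U" for A U :: "'a set"
    using open_Int_closure_eq_empty[OF that, of A] by (simp add: Int_commute)
  then show ?thesis
    using assms by (simp add: set_valued_measurable_def)
qed

lemma set_valued_measurable_Un:
  fixes X Y :: "'e \<Rightarrow> 'a::topological_space set"
  assumes "set_valued_measurable E X" "set_valued_measurable E Y"
  shows "set_valued_measurable E (\<lambda>e. X e \<union> Y e)"
  unfolding set_valued_measurable_def
proof (intro allI impI)
  fix U :: "'a set" assume "open U"
  have "{e \<in> space E. (X e \<union> Y e) \<inter> U \<noteq> {}} =
      {e \<in> space E. X e \<inter> U \<noteq> {}} \<union> {e \<in> space E. Y e \<inter> U \<noteq> {}}"
    by auto
  then show "{e \<in> space E. (X e \<union> Y e) \<inter> U \<noteq> {}} \<in> sets E"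
    using assms \<open>open U\<close> by (simp add: set_valued_measurable_def sets.Un)
qed

lemma set_valued_measurable_UN:
  fixes X :: "'i \<Rightarrow> 'e \<Rightarrow> 'a::topological_space set"
  assumes "countable I" "\<And>i. i \<in> I \<Longrightarrow> set_valued_measurable E (X i)"
  shows "set_valued_measurable E (\<lambda>e. \<Union>i\<in>I. X i e)"
  unfolding set_valued_measurable_def
proof (intro allI impI)
  fix U :: "'a set" assume "open U"
  have "{e \<in> space E. (\<Union>i\<in>I. X i e) \<inter> U \<noteq> {}} = (\<Union>i\<in>I. {e \<in> space E. X i e \<inter> U \<noteq> {}})"
    by auto
  also have "\<dots> \<in> sets E"
    using assms \<open>open U\<close> by (intro sets.countable_UN'') (auto simp: set_valued_measurable_def)
  finally show "{e \<in> space E. (\<Union>i\<in>I. X i e) \<inter> U \<noteq> {}} \<in> sets E" .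
qed

text \<open>Addition is continuous, so each sum in \<open>U\<close> comes from basic neighbourhoods
  \<open>V\<close>, \<open>W\<close> of its summands with \<open>V + W\<close> inside
  \<open>U\<close>. The event that \<open>X e + Y e\<close> hits \<open>U\<close> is therefore a
  countable union of events of the form "\<open>X e\<close> hits \<open>V\<close> and
  \<open>Y e\<close> hits \<open>W\<close>".\<close>

lemma set_valued_measurable_set_plus:
  fixes X Y :: "'e \<Rightarrow> 'a::{topological_monoid_add, second_countable_topology} set"
  assumes X: "set_valued_measurable E X" and Y: "set_valued_measurable E Y"
  shows "set_valued_measurable E (\<lambda>e. X e + Y e)"
  unfolding set_valued_measurable_def
proof (intro allI impI)
  fix U :: "'a set" assume "open U"
  obtain \<B> :: "'a set set" where \<B>: "countable \<B>" "topological_basis \<B>"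
    using ex_countable_basis by blast
  define I where "I = {(V, W) \<in> \<B> \<times> \<B>. V + W \<subseteq> U}"
  have "countable I"
    by (rule countable_subset[of _ "\<B> \<times> \<B>"]) (auto simp: I_def \<B>(1))
  have dec: "\<exists>(V, W)\<in>I. x \<in> V \<and> y \<in> W" if xy: "x + y \<in> U" for x y
  proof -
    have "continuous_on UNIV (\<lambda>z::'a \<times> 'a. fst z + snd z)"
      by (intro continuous_intros)
    then have "open ((\<lambda>z. fst z + snd z) -` U)"
      using \<open>open U\<close> by (rule open_vimage[rotated])
    moreover have "(x, y) \<in> (\<lambda>z. fst z + snd z) -` U"
      using xy by simp
    ultimately obtain V W where "open V" "open W" "(x, y) \<in> V \<times> W"
        and VW: "V \<times> W \<subseteq> (\<lambda>z. fst z + snd z) -` U"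
      by (rule open_prod_elim)
    then have "x \<in> V" "y \<in> W"
      by auto
    obtain V' where V': "V' \<in> \<B>" "x \<in> V'" "V' \<subseteq> V"
      using topological_basisE[OF \<B>(2) \<open>open V\<close> \<open>x \<in> V\<close>] by blast
    obtain W' where W': "W' \<in> \<B>" "y \<in> W'" "W' \<subseteq> W"
      using topological_basisE[OF \<B>(2) \<open>open W\<close> \<open>y \<in> W\<close>] by blast
    have "V' + W' \<subseteq> U"
      using V' W' VW by (fastforce simp: set_plus_def)
    then show ?thesis
      using V' W' by (auto simp: I_def intro!: bexI[of _ "(V', W')"])
  qed
  have "{e \<in> space E. (X e + Y e) \<inter> U \<noteq> {}} =
      (\<Union>(V, W)\<in>I. {e \<in> space E. X e \<inter> V \<noteq> {}} \<inter> {e \<in> space E. Y e \<inter> W \<noteq> {}})"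
  proof (intro equalityI subsetI)
    fix e assume "e \<in> {e \<in> space E. (X e + Y e) \<inter> U \<noteq> {}}"
    then obtain x y where "e \<in> space E" "x \<in> X e" "y \<in> Y e" "x + y \<in> U"
      by (auto simp: set_plus_def)
    with dec show "e \<in> (\<Union>(V, W)\<in>I. {e \<in> space E. X e \<inter> V \<noteq> {}} \<inter> {e \<in> space E. Y e \<inter> W \<noteq> {}})"
      by blast
  next
    fix e assume "e \<in> (\<Union>(V, W)\<in>I. {e \<in> space E. X e \<inter> V \<noteq> {}} \<inter> {e \<in> space E. Y e \<inter> W \<noteq> {}})"
    then obtain V W x y where "V + W \<subseteq> U" "e \<in> space E" "x \<in> X e" "x \<in> V" "y \<in> Y e" "y \<in> W"
      by (auto simp: I_def)
    then show "e \<in> {e \<in> space E. (X e + Y e) \<inter> U \<noteq> {}}"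
      by (blast intro: set_plus_intro)
  qed
  also have "\<dots> \<in> sets E"
    using \<open>countable I\<close> X Y \<B>(2)
    by (intro sets.countable_UN'')
       (auto simp: I_def intro!: sets.Int set_valued_measurableD dest: topological_basis_open)
  finally show "{e \<in> space E. (X e + Y e) \<inter> U \<noteq> {}} \<in> sets E" .
qed

lemma set_valued_measurable_closed_minkowski_sum:
  fixes X Y :: "'e \<Rightarrow> 'a::{real_normed_vector, second_countable_topology} set"
  assumes "set_valued_measurable E X" "set_valued_measurable E Y"
  shows "set_valued_measurable E (\<lambda>e. closed_minkowski_sum (X e) (Y e))"
  unfolding closed_minkowski_sum_def
  by (intro set_valued_measurable_closure set_valued_measurable_set_plus assms)

text \<open>By the Lindelof property an open set is a countable union of balls. Testing on balls
  makes connectedness of the test set available for the difference below.\<close>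

lemma set_valued_measurable_ballI:
  fixes X :: "'e \<Rightarrow> 'a::{metric_space, second_countable_topology} set"
  assumes "\<And>x r. {e \<in> space E. X e \<inter> ball x r \<noteq> {}} \<in> sets E"
  shows "set_valued_measurable E X"
  unfolding set_valued_measurable_def
proof (intro allI impI)
  fix U :: "'a set" assume "open U"
  define \<F> where "\<F> = {S. S \<subseteq> U \<and> (\<exists>x r. S = ball x r)}"
  obtain \<F>' where \<F>': "\<F>' \<subseteq> \<F>" "countable \<F>'" "\<Union>\<F>' = \<Union>\<F>"
    by (rule Lindelof[of \<F>]) (auto simp: \<F>_def)
  have "U = \<Union>\<F>"
  proof (intro equalityI subsetI)
    fix x assume "x \<in> U"
    then obtain r where "0 < r" "ball x r \<subseteq> U"
      using \<open>open U\<close> openE by blast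
    then show "x \<in> \<Union>\<F>"
      by (intro UnionI[of "ball x r"]) (auto simp: \<F>_def)
  qed (auto simp: \<F>_def)
  then have "{e \<in> space E. X e \<inter> U \<noteq> {}} = (\<Union>S\<in>\<F>'. {e \<in> space E. X e \<inter> S \<noteq> {}})"
    unfolding \<F>'(3)[symmetric] by blast
  also have "\<dots> \<in> sets E"
    using \<F>' assms by (intro sets.countable_UN'') (auto simp: \<F>_def)
  finally show "{e \<in> space E. X e \<inter> U \<noteq> {}} \<in> sets E" .
qed

text \<open>Since balls are connected, \<open>X - interior Y\<close> meets a ball \<open>V\<close> iff either \<open>V\<close> meets both
  \<open>Y\<close> and its complement, or \<open>X\<close> meets \<open>V - Y\<close>; no measurability of intersections, hence no
  projection theorem, is needed.\<close>
lemma set_valued_measurable_diff_interior: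
  fixes X Y :: "'e \<Rightarrow> 'a::{real_normed_vector, second_countable_topology} set"
  assumes X: "set_valued_measurable E X" and Y: "set_valued_measurable E Y"
    and clY: "\<And>e. e \<in> space E \<Longrightarrow> closed (Y e)"
    and YX: "\<And>e. e \<in> space E \<Longrightarrow> Y e \<subseteq> X e"
  shows "set_valued_measurable E (\<lambda>e. X e - interior (Y e))"
proof (rule set_valued_measurable_ballI)
  fix x :: 'a and r :: real
  define V where "V = ball x r"
  have V: "open V" "connected V"
    by (simp_all add: V_def)
  obtain \<B> :: "'a set set" where \<B>: "countable \<B>" "topological_basis \<B>"
    using ex_countable_basis by blast
  \<comment> \<open>Empty members are excluded so that any \<open>W\<close> in \<open>I\<close>
    disjoint from \<open>Y e\<close> witnesses that \<open>V\<close> is not contained in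
    \<open>Y e\<close>.\<close>
  define I where "I = {W \<in> \<B>. W \<subseteq> V \<and> W \<noteq> {}}"
  have "countable I"
    using \<B>(1) by (auto simp: I_def)
  have opI: "open W" if "W \<in> I" for W
    using that topological_basis_open[OF \<B>(2)] by (auto simp: I_def)
  have hit: "\<exists>W\<in>I. z \<in> W \<and> W \<inter> Y e = {}" if "z \<in> V" "z \<notin> Y e" "e \<in> space E" for z e
  proof -
    have "open (V - Y e)"
      using V(1) clY[OF that(3)] by (rule open_Diff)
    moreover have "z \<in> V - Y e"
      using that by blast
    ultimately obtain W where "W \<in> \<B>" "z \<in> W" "W \<subseteq> V - Y e"
      using topological_basisE[OF \<B>(2)] by metis
    then show ?thesis
      by (intro bexI[of _ W]) (auto simp: I_def)
  qed
  \<comment> \<open>The set \<open>V - Y e\<close> varies with \<open>e\<close>; basic sets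
    \<open>W\<close> inside it replace it, so that the right-hand side consists of hitting events of
    fixed open sets and their complements.\<close>
  have eq: "(X e - interior (Y e)) \<inter> V \<noteq> {} \<longleftrightarrow>
      (\<exists>W\<in>I. Y e \<inter> W = {} \<and> X e \<inter> W \<noteq> {}) \<or> (Y e \<inter> V \<noteq> {} \<and> (\<exists>W\<in>I. Y e \<inter> W = {}))"
    (is "?L \<longleftrightarrow> ?R") if e: "e \<in> space E" for e
  proof
    assume ?L
    then obtain z where z: "z \<in> X e" "z \<notin> interior (Y e)" "z \<in> V"
      by blast
    show ?R
    proof (cases "z \<in> Y e")
      case False
      then show ?thesis
        using hit[OF z(3) False e] z(1) by blast
    next
      case True
      \<comment> \<open>Otherwise the open set \<open>V\<close> would lie in the interior of
        \<open>Y e\<close>, and so would \<open>z\<close>.\<close>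
      have "\<not> V \<subseteq> Y e"
        using z V(1) interior_maximal by blast
      then obtain z' where "z' \<in> V" "z' \<notin> Y e"
        by blast
      with hit[OF this e] True z(3) show ?thesis
        by (intro disjI2) (auto simp: Int_commute)
    qed
  next
    assume ?R
    then show ?L
    proof (elim disjE bexE conjE)
      fix W assume "W \<in> I" "Y e \<inter> W = {}" "X e \<inter> W \<noteq> {}"
      then show ?L
        using interior_subset by (fastforce simp: I_def)
    next
      fix W assume W: "Y e \<inter> V \<noteq> {}" "W \<in> I" "Y e \<inter> W = {}"
      \<comment> \<open>\<open>V\<close> is connected and meets both \<open>Y e\<close> and its
        complement. As \<open>Y e\<close> is closed, its frontier is
        \<open>Y e - interior (Y e)\<close>, which lies in
        \<open>X e - interior (Y e)\<close>.\<close>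
      then have "V \<inter> frontier (Y e) \<noteq> {}"
        by (intro connected_Int_frontier[OF V(2)]) (auto simp: I_def)
      then show ?L
        using YX[OF e] clY[OF e] by (auto simp: frontier_def)
    qed
  qed
  define H where "H X W = {e \<in> space E. X e \<inter> W \<noteq> {}}" for X :: "'e \<Rightarrow> 'a set" and W
  have "{e \<in> space E. (X e - interior (Y e)) \<inter> V \<noteq> {}} =
      (\<Union>W\<in>I. H X W - H Y W) \<union> (H Y V \<inter> (\<Union>W\<in>I. space E - H Y W))"
    using eq by (auto simp: H_def)
  also have "\<dots> \<in> sets E"
    using \<open>countable I\<close> X Y opI V(1) unfolding H_def
    by (intro sets.Un sets.Int sets.countable_UN'' sets.Diff sets.top set_valued_measurableD)
  finally show "{e \<in> space E. (X e - interior (Y e)) \<inter> ball x r \<noteq> {}} \<in> sets E"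
    unfolding V_def .
qed

section \<open>Castaing representations\<close>

text \<open>One refinement step of the Kuratowski-Ryll-Nardzewski construction. A point of
  \<open>X e\<close> lies within \<open>r\<close> of \<open>f e\<close>, and a point of a countable
  dense set within \<open>s\<close> of that one; taking the first suitable index in an enumeration
  keeps the choice measurable.\<close>

lemma near_selection_step:
  fixes X :: "'e \<Rightarrow> 'a::{metric_space, second_countable_topology} set"
  assumes X: "set_valued_measurable E X" and f[measurable]: "f \<in> borel_measurable E"
    and near: "\<And>e. e \<in> space E \<Longrightarrow> X e \<inter> ball (f e) r \<noteq> {}" and "0 < s"
  shows "\<exists>g\<in>borel_measurable E. \<forall>e\<in>space E. X e \<inter> ball (g e) s \<noteq> {} \<and> dist (f e) (g e) < r + s"
proof -
  obtain D :: "'a set" where D: "countable D" "\<And>U. open U \<Longrightarrow> U \<noteq> {} \<Longrightarrow> \<exists>d\<in>D. d \<in> U"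
    using countable_dense_setE by blast
  define d where "d = from_nat_into D"
  have "D \<noteq> {}"
    using D(2)[of UNIV] by auto
  then have d: "\<exists>i. d i \<in> U" if U: "open U" "U \<noteq> {}" for U
  proof -
    obtain y where "y \<in> D" "y \<in> U"
      using D(2)[OF U] by blast
    then show ?thesis
      using from_nat_into_surj[OF D(1), of y] unfolding d_def by auto
  qed
  define P where "P i e \<longleftrightarrow> X e \<inter> ball (d i) s \<noteq> {} \<and> dist (f e) (d i) < r + s" for i e
  have [measurable]: "Measurable.pred E (\<lambda>e. X e \<inter> ball (d i) s \<noteq> {})" for i
    using set_valued_measurableD[OF X open_ball] by (simp add: pred_def)
  have P[measurable]: "Measurable.pred E (P i)" for i
    unfolding P_def by measurable
  define g where "g e = d (LEAST i. P i e)" for e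
  have "g \<in> borel_measurable E"
    unfolding g_def
    by (rule measurable_compose[of "\<lambda>e. LEAST i. P i e" _ "count_space UNIV" d]) measurable
  moreover have "P (LEAST i. P i e) e" if e: "e \<in> space E" for e
  proof -
    obtain x where x: "x \<in> X e" "dist (f e) x < r"
      using near[OF e] by auto
    obtain i where "dist x (d i) < s"
      using d[of "ball x s"] \<open>0 < s\<close> by auto
    with x have "P i e"
      using dist_triangle[of "f e" "d i" x] by (auto simp: P_def dist_commute)
    then show ?thesis
      by (rule LeastI)
  qed
  ultimately show ?thesis
    by (intro bexI[of _ g]) (simp_all add: P_def g_def)
qed

text \<open>The Kuratowski-Ryll-Nardzewski selection theorem with a bound on the displacement.
  Refinement with radii \<open>r / 2 ^ k\<close> moves the map by less than
  \<open>r / 2 ^ k + r / 2 ^ Suc k\<close> at stage \<open>k\<close>; these bounds sum to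
  \<open>3 * r\<close>.\<close>

lemma measurable_selection_near:
  fixes X :: "'e \<Rightarrow> 'a::{complete_space, second_countable_topology} set"
  assumes X: "set_valued_measurable E X" and cl: "\<And>e. e \<in> space E \<Longrightarrow> closed (X e)"
    and f: "f \<in> borel_measurable E" and "0 < r"
    and near: "\<And>e. e \<in> space E \<Longrightarrow> X e \<inter> ball (f e) r \<noteq> {}"
  shows "\<exists>g\<in>borel_measurable E. \<forall>e\<in>space E. g e \<in> X e \<and> dist (f e) (g e) \<le> 3 * r"
proof -
  \<comment> \<open>The clause for \<open>k = 0\<close> pins the start of the sequence to
    \<open>f\<close>, from which the final distance is measured.\<close>
  define P where "P k h \<longleftrightarrow> h \<in> borel_measurable E \<and> (k = 0 \<longrightarrow> h = f) \<and>
      (\<forall>e\<in>space E. X e \<inter> ball (h e) (r / 2 ^ k) \<noteq> {})" for k :: nat and h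
  \<comment> \<open>The bound equals \<open>r / 2 ^ k + r / 2 ^ Suc k\<close>, written as a
    difference so that consecutive distances telescope.\<close>
  define Q where "Q k h h' \<longleftrightarrow> (\<forall>e\<in>space E. dist (h e) (h' e) < 3 * r / 2 ^ k - 3 * r / 2 ^ Suc k)"
    for k :: nat and h h' :: "'e \<Rightarrow> 'a"
  have "\<exists>h. \<forall>k. P k (h k) \<and> Q k (h k) (h (Suc k))"
  proof (rule dependent_nat_choice)
    show "\<exists>h. P 0 h"
      using f near by (auto simp: P_def)
  next
    fix h k assume "P k h"
    then have "\<exists>g\<in>borel_measurable E. \<forall>e\<in>space E. X e \<inter> ball (g e) (r / 2 ^ Suc k) \<noteq> {} \<and>
        dist (h e) (g e) < r / 2 ^ k + r / 2 ^ Suc k"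
      using \<open>0 < r\<close> by (intro near_selection_step X) (auto simp: P_def)
    then show "\<exists>g. P (Suc k) g \<and> Q k h g"
      by (auto simp: P_def Q_def field_simps)
  qed
  then obtain h where h: "\<And>k. P k (h k)" "\<And>k. Q k (h k) (h (Suc k))"
    by blast
  have dist_h: "dist (h k e) (h (k + m) e) \<le> 3 * r / 2 ^ k - 3 * r / 2 ^ (k + m)"
    if e: "e \<in> space E" for e k m
  proof (induction m)
    case (Suc m)
    have "dist (h (k + m) e) (h (Suc (k + m)) e) \<le> 3 * r / 2 ^ (k + m) - 3 * r / 2 ^ Suc (k + m)"
      using h(2)[of "k + m"] e by (auto simp: Q_def intro: less_imp_le)
    with Suc show ?case
      using dist_triangle[of "h k e" "h (k + Suc m) e" "h (k + m) e"] by simp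
  qed simp
  have lim0: "(\<lambda>k. c / 2 ^ k) \<longlonglongrightarrow> 0" for c :: real
    using tendsto_mult[OF tendsto_const[of c] LIMSEQ_power_zero[of "1 / 2 :: real"]]
    by (simp add: power_divide)
  have "Cauchy (\<lambda>k. h k e)" if e: "e \<in> space E" for e
  proof (rule metric_CauchyI)
    fix \<epsilon> :: real assume "0 < \<epsilon>"
    then have "eventually (\<lambda>k. 3 * r / 2 ^ k < \<epsilon> / 2) sequentially"
      using lim0[of "3 * r"] by (intro order_tendstoD) auto
    then obtain k where k: "3 * r / 2 ^ k < \<epsilon> / 2"
      by (auto simp: eventually_sequentially)
    have "dist (h k e) (h l e) < \<epsilon> / 2" if "k \<le> l" for l
    proof -
      have "0 < 3 * r / 2 ^ l"
        using \<open>0 < r\<close> by simp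
      then show ?thesis
        using dist_h[OF e, of k "l - k"] that k by simp
    qed
    then show "\<exists>k. \<forall>m\<ge>k. \<forall>n\<ge>k. dist (h m e) (h n e) < \<epsilon>"
      using dist_triangle_half_r by blast
  qed
  then have lim: "(\<lambda>k. h k e) \<longlonglongrightarrow> lim (\<lambda>k. h k e)" if "e \<in> space E" for e
    using that by (simp add: Cauchy_convergent_iff convergent_LIMSEQ_iff)
  define g where "g e = lim (\<lambda>k. h k e)" for e
  have "g \<in> borel_measurable E"
    unfolding g_def by (rule borel_measurable_LIMSEQ_metric[OF _ lim]) (use h(1) in \<open>simp_all add: P_def\<close>)
  moreover have "g e \<in> X e" if e: "e \<in> space E" for e
  proof -
    \<comment> \<open>The approximants \<open>h k e\<close> need not lie in \<open>X e\<close>.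
      Points of \<open>X e\<close> at vanishing distance from them have the same limit, and
      \<open>X e\<close> is closed.\<close>
    have "\<exists>y. y \<in> X e \<and> dist (h k e) y < r / 2 ^ k" for k
      using h(1)[of k] e by (auto simp: P_def)
    then obtain x where x: "\<And>k. x k \<in> X e" "\<And>k. dist (h k e) (x k) < r / 2 ^ k"
      by metis
    have "(\<lambda>k. dist (h k e) (x k)) \<longlonglongrightarrow> 0"
      by (rule tendsto_sandwich[OF _ _ tendsto_const lim0[of r]])
         (auto intro!: always_eventually less_imp_le x(2))
    moreover have "(\<lambda>k. dist (h k e) (g e)) \<longlonglongrightarrow> 0"
      using lim[OF e] unfolding g_def by (rule tendsto_dist_iff[THEN iffD1])
    ultimately have "(\<lambda>k. dist (h k e) (x k) + dist (h k e) (g e)) \<longlonglongrightarrow> 0"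
      by (rule tendsto_add_zero)
    then have "(\<lambda>k. dist (x k) (g e)) \<longlonglongrightarrow> 0"
      by (rule tendsto_sandwich[OF _ _ tendsto_const, rotated 2]) (simp_all add: dist_triangle3)
    then have "x \<longlonglongrightarrow> g e"
      by (rule tendsto_dist_iff[THEN iffD2])
    then show ?thesis
      using closed_sequentially[OF cl[OF e]] x(1) by blast
  qed
  moreover have "dist (f e) (g e) \<le> 3 * r" if e: "e \<in> space E" for e
  proof (rule LIMSEQ_le_const2)
    show "(\<lambda>k. dist (f e) (h k e)) \<longlonglongrightarrow> dist (f e) (g e)"
      using lim[OF e] unfolding g_def by (intro tendsto_intros)
    have "dist (f e) (h k e) \<le> 3 * r" for k
    proof -
      have "0 < 3 * r / 2 ^ k"
        using \<open>0 < r\<close> by simp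
      then show ?thesis
        using dist_h[OF e, of 0 k] h(1)[of 0] by (simp add: P_def)
    qed
    then show "\<exists>N. \<forall>k\<ge>N. dist (f e) (h k e) \<le> 3 * r"
      by blast
  qed
  ultimately show ?thesis
    by (intro bexI[of _ g]) simp_all
qed

text \<open>For each dense point \<open>d j\<close> and radius \<open>\<delta> n\<close>, a
  measurable selection is taken that stays within \<open>3 * \<delta> n\<close> of
  \<open>d j\<close> wherever \<open>X e\<close> comes within \<open>\<delta> n\<close> of
  \<open>d j\<close>. The countably many selections obtained are dense in every
  \<open>X e\<close>.\<close>

lemma castaing_representation:
  fixes X :: "'e \<Rightarrow> 'a::{complete_space, second_countable_topology} set"
  assumes X: "set_valued_measurable E X"
    and cl: "\<And>e. e \<in> space E \<Longrightarrow> closed (X e)" and ne: "\<And>e. e \<in> space E \<Longrightarrow> X e \<noteq> {}"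
  obtains c :: "nat \<Rightarrow> 'e \<Rightarrow> 'a" where "\<And>i. c i \<in> borel_measurable E"
    and "\<And>i e. e \<in> space E \<Longrightarrow> c i e \<in> X e"
    and "\<And>e. e \<in> space E \<Longrightarrow> X e \<subseteq> closure (range (\<lambda>i. c i e))"
proof -
  obtain D :: "'a set" where D: "countable D" "\<And>U. open U \<Longrightarrow> U \<noteq> {} \<Longrightarrow> \<exists>d\<in>D. d \<in> U"
    using countable_dense_setE by blast
  define d where "d = from_nat_into D"
  have "D \<noteq> {}"
    using D(2)[of UNIV] by auto
  then have d: "\<exists>i. d i \<in> U" if U: "open U" "U \<noteq> {}" for U
  proof -
    obtain y where "y \<in> D" "y \<in> U"
      using D(2)[OF U] by blast
    then show ?thesis
      using from_nat_into_surj[OF D(1), of y] unfolding d_def by auto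
  qed
  define \<delta> where "\<delta> n = 1 / real (Suc n)" for n
  have \<delta>: "0 < \<delta> n" for n
    by (simp add: \<delta>_def)
  have ex: "\<exists>g\<in>borel_measurable E. \<forall>e\<in>space E. g e \<in> X e \<and>
      (X e \<inter> ball (d j) (\<delta> n) \<noteq> {} \<longrightarrow> dist (d j) (g e) \<le> 3 * \<delta> n)" for j n
  proof -
    define P where "P i e \<longleftrightarrow> X e \<inter> ball (d i) (\<delta> n) \<noteq> {}" for i e
    have P[measurable]: "Measurable.pred E (P i)" for i
      using set_valued_measurableD[OF X open_ball] by (simp add: pred_def P_def)
    \<comment> \<open>Where the ball around \<open>d j\<close> misses \<open>X e\<close>, the first
      dense point whose ball does meet it serves as a default, so that the selection lemma applies
      on all of \<open>E\<close>.\<close>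
    define f where "f e = d (if P j e then j else LEAST i. P i e)" for e
    have "f \<in> borel_measurable E"
      unfolding f_def
      by (rule measurable_compose[of "\<lambda>e. if P j e then j else LEAST i. P i e" _ "count_space UNIV" d])
         measurable
    moreover have "X e \<inter> ball (f e) (\<delta> n) \<noteq> {}" if e: "e \<in> space E" for e
    proof -
      obtain x where x: "x \<in> X e"
        using ne[OF e] by blast
      obtain i where "d i \<in> ball x (\<delta> n)"
        using d[of "ball x (\<delta> n)"] \<delta>[of n] by auto
      with x have "P i e"
        by (auto simp: P_def dist_commute)
      then have "P (LEAST i. P i e) e"
        by (rule LeastI)
      then show ?thesis
        unfolding f_def by (auto simp: P_def)
    qed
    moreover have "f e = d j" if "X e \<inter> ball (d j) (\<delta> n) \<noteq> {}" for e
      using that by (simp add: f_def P_def)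
    ultimately show ?thesis
      using measurable_selection_near[OF X cl _ \<delta>] by metis
  qed
  define c where "c j n = (SOME g. g \<in> borel_measurable E \<and> (\<forall>e\<in>space E. g e \<in> X e \<and>
      (X e \<inter> ball (d j) (\<delta> n) \<noteq> {} \<longrightarrow> dist (d j) (g e) \<le> 3 * \<delta> n)))" for j n
  have c: "c j n \<in> borel_measurable E" "\<And>e. e \<in> space E \<Longrightarrow> c j n e \<in> X e"
      "\<And>e. e \<in> space E \<Longrightarrow> X e \<inter> ball (d j) (\<delta> n) \<noteq> {} \<Longrightarrow> dist (d j) (c j n e) \<le> 3 * \<delta> n" for j n
    using someI_ex[OF ex[of j n, unfolded Bex_def]] unfolding c_def by auto
  show ?thesis
  proof
    fix e assume e: "e \<in> space E"
    show "X e \<subseteq> closure (range (\<lambda>i. c (fst (prod_decode i)) (snd (prod_decode i)) e))"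
    proof
      fix x assume x: "x \<in> X e"
      have "\<exists>y\<in>range (\<lambda>i. c (fst (prod_decode i)) (snd (prod_decode i)) e). dist y x < \<epsilon>" if "0 < \<epsilon>" for \<epsilon>
      proof -
        \<comment> \<open>A quarter suffices: \<open>d j\<close> is within \<open>\<delta> n\<close>
          of \<open>x\<close>, and the selection within \<open>3 * \<delta> n\<close> of
          \<open>d j\<close>.\<close>
        obtain n where n: "\<delta> n < \<epsilon> / 4"
          using reals_Archimedean[of "\<epsilon> / 4"] \<open>0 < \<epsilon>\<close> by (auto simp: \<delta>_def inverse_eq_divide)
        obtain j where j: "dist x (d j) < \<delta> n"
          using d[of "ball x (\<delta> n)"] \<delta>[of n] by auto
        then have "dist (d j) (c j n e) \<le> 3 * \<delta> n"
          using x by (intro c(3)[OF e]) (auto simp: dist_commute)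
        with j n have "dist (c j n e) x < \<epsilon>"
          using dist_triangle[of "c j n e" x "d j"] by (simp add: dist_commute)
        then show ?thesis
          by (intro bexI[of _ "c j n e"]) (auto intro!: image_eqI[of _ _ "prod_encode (j, n)"])
      qed
      then show "x \<in> closure (range (\<lambda>i. c (fst (prod_decode i)) (snd (prod_decode i)) e))"
        unfolding closure_approachable by blast
    qed
  qed (simp_all add: c)
qed

section \<open>Measurability of the Aumann integral\<close>

text \<open>The codes \<open>q\<close> (inverse mesh, values) form a countable type. Beyond the end of the list, \<open>nth\<close>
  returns some unspecified index, which still gives a measurable function.\<close>
definition step_index :: "real \<Rightarrow> nat \<times> nat list \<Rightarrow> real \<Rightarrow> nat" where
  "step_index a q \<tau> = snd q ! nat \<lfloor>(\<tau> - a) * real (fst q)\<rfloor>"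

lemma measurable_step_index[measurable]: "step_index a q \<in> measurable borel (count_space UNIV)"
  unfolding step_index_def
  by (rule measurable_compose[of "\<lambda>\<tau>. nat \<lfloor>(\<tau> - a) * real (fst q)\<rfloor>" _ "count_space UNIV"]) measurable

text \<open>An integer-valued measurable function is an a.e. limit of continuous functions; sampling
  these on a fine grid and rounding gives step functions that are eventually equal to it.\<close>
lemma step_index_eventually_eq:
  assumes N: "N \<in> measurable lebesgue (count_space UNIV)"
  shows "\<exists>q. AE \<tau> in lebesgue. \<tau> \<in> {a..b} \<longrightarrow> (\<forall>\<^sub>F k in sequentially. step_index a (q k) \<tau> = N \<tau>)"
proof -
  have "(\<lambda>\<tau>. real (N \<tau>)) measurable_on UNIV"
    using N by (intro lebesgue_measurable_imp_measurable_on) (auto intro: measurable_compose)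
  then obtain Z g where Z: "negligible Z" and g: "\<And>k. continuous_on UNIV (g k)"
      and lim: "\<And>\<tau>. \<tau> \<notin> Z \<Longrightarrow> (\<lambda>k. g k \<tau>) \<longlonglongrightarrow> real (N \<tau>)"
    unfolding measurable_on_def by auto
  \<comment> \<open>One code \<open>q\<close> serves all points where \<open>g k\<close> is already
    \<open>1/4\<close>-close to \<open>N\<close>. Sampling costs at most another \<open>1/4\<close>,
    and an error below \<open>1/2\<close> is removed by rounding.\<close>
  have "\<exists>q. \<forall>\<tau>\<in>{a..b}. \<bar>g k \<tau> - real (N \<tau>)\<bar> < 1/4 \<longrightarrow> step_index a q \<tau> = N \<tau>" for k
  proof -
    have "uniformly_continuous_on {a..b} (g k)"
      by (rule compact_uniformly_continuous) (auto intro: continuous_on_subset[OF g])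
    then obtain d where "0 < d"
        and d: "\<And>x y. x \<in> {a..b} \<Longrightarrow> y \<in> {a..b} \<Longrightarrow> dist x y < d \<Longrightarrow> dist (g k x) (g k y) < 1/4"
      unfolding uniformly_continuous_on_def by (elim allE[of _ "1/4"]) (auto simp: dist_commute)
    obtain m where m: "0 < m" "inverse (real m) < d"
      using ex_inverse_of_nat_less[OF \<open>0 < d\<close>] by blast
    \<comment> \<open>The \<open>Suc\<close> supplies an entry for the grid index of the right
      endpoint \<open>b\<close> itself.\<close>
    define l where "l = map (\<lambda>j. nat (round (g k (a + real j / real m)))) [0..<Suc (nat \<lfloor>(b - a) * real m\<rfloor>)]"
    have "step_index a (m, l) \<tau> = N \<tau>" if \<tau>: "\<tau> \<in> {a..b}" "\<bar>g k \<tau> - real (N \<tau>)\<bar> < 1/4" for \<tau>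
    proof -
      define j where "j = nat \<lfloor>(\<tau> - a) * real m\<rfloor>"
      have "0 \<le> (\<tau> - a) * real m"
        using \<tau> by simp
      then have j: "real j \<le> (\<tau> - a) * real m" "(\<tau> - a) * real m < real j + 1"
        unfolding j_def by linarith+
      then have "a + real j / real m \<le> \<tau>" "\<tau> < a + real j / real m + inverse (real m)"
        using m(1) by (simp_all add: field_simps)
      then have "\<bar>g k (a + real j / real m) - g k \<tau>\<bar> < 1/4"
        using \<tau> m unfolding dist_real_def[symmetric] by (intro d) (auto simp: dist_real_def)
      with \<tau>(2) have "\<bar>g k (a + real j / real m) - real (N \<tau>)\<bar> < 1/2"
        by linarith
      then have "round (g k (a + real j / real m)) = int (N \<tau>)"
        by (intro round_unique') simp
      moreover have "j \<le> nat \<lfloor>(b - a) * real m\<rfloor>"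
        using \<tau> unfolding j_def by (intro nat_mono floor_mono mult_right_mono) auto
      ultimately show ?thesis
        unfolding step_index_def by (simp add: l_def j_def[symmetric] nth_append del: upt_Suc)
    qed
    then show ?thesis
      by blast
  qed
  then obtain q where q: "\<And>k \<tau>. \<tau> \<in> {a..b} \<Longrightarrow> \<bar>g k \<tau> - real (N \<tau>)\<bar> < 1/4 \<Longrightarrow> step_index a (q k) \<tau> = N \<tau>"
    by metis
  have ev: "\<forall>\<^sub>F k in sequentially. step_index a (q k) \<tau> = N \<tau>" if "\<tau> \<notin> Z" "\<tau> \<in> {a..b}" for \<tau>
  proof -
    have "\<forall>\<^sub>F k in sequentially. dist (g k \<tau>) (real (N \<tau>)) < 1/4"
      by (rule tendstoD[OF lim[OF that(1)]]) simp
    then show ?thesis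
      by (rule eventually_mono) (use q that(2) in \<open>auto simp: dist_real_def\<close>)
  qed
  have "AE \<tau> in lebesgue. \<tau> \<in> {a..b} \<longrightarrow> (\<forall>\<^sub>F k in sequentially. step_index a (q k) \<tau> = N \<tau>)"
    using ev Z unfolding negligible_iff_null_sets by (intro AE_I'[of Z]) auto
  then show ?thesis
    by blast
qed

lemma integrable_indicator_Icc_mult:
  fixes C :: real
  shows "integrable lebesgue (\<lambda>\<tau>. indicator {a..b::real} \<tau> * C)"
  by (intro integrable_mult_left integrable_real_indicator) (auto simp: emeasure_lborel_Icc_eq)

text \<open>The witness comes from a countable type even though \<open>g\<close> is arbitrary. First
  \<open>g\<close> is replaced, up to a uniform error \<open>\<delta>\<close>, by the selection
  \<open>c (N \<tau>) \<tau>\<close>; then dominated convergence replaces \<open>N\<close> by step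
  indices. Openness of \<open>U\<close> absorbs both errors.\<close>

lemma aumann_integral_step_selection:
  fixes c :: "nat \<Rightarrow> real \<Rightarrow> 'x::{banach, second_countable_topology}"
  assumes c: "\<And>i. c i \<in> borel_measurable borel"
    and bound: "\<And>i \<tau>. \<tau> \<in> {t0..T} \<Longrightarrow> norm (c i \<tau>) \<le> C"
    and dense: "\<And>\<tau>. \<tau> \<in> {t0..T} \<Longrightarrow> H \<tau> \<subseteq> closure (range (\<lambda>i. c i \<tau>))"
    and ab: "t0 \<le> a" "b \<le> T"
    and U: "open U" "x \<in> U" and x: "x \<in> aumann_integral t0 T H a b"
  shows "\<exists>q. set_lebesgue_integral lebesgue {a..b} (\<lambda>\<tau>. c (step_index a q \<tau>) \<tau>) \<in> U"
proof -
  obtain g where g: "set_integrable lebesgue {t0..T} g"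
      and gH: "AE \<tau> in lebesgue. \<tau> \<in> {t0..T} \<longrightarrow> g \<tau> \<in> H \<tau>"
      and xg: "x = set_lebesgue_integral lebesgue {a..b} g"
    using x by (auto simp: aumann_integral_def)
  obtain \<epsilon> where \<epsilon>: "0 < \<epsilon>" "ball x \<epsilon> \<subseteq> U"
    using U openE by blast
  \<comment> \<open>Chosen so that a uniform error \<open>\<delta>\<close> on \<open>{a..b}\<close>
    changes the integral by less than \<open>\<epsilon>\<close>; the \<open>+ 1\<close> avoids
    division by zero when \<open>a = b\<close>.\<close>
  define \<delta> where "\<delta> = \<epsilon> / (\<bar>b - a\<bar> + 1)"
  have "0 < \<delta>"
    using \<epsilon> by (simp add: \<delta>_def)
  have sub: "{a..b} \<subseteq> {t0..T}"
    using ab by auto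
  \<comment> \<open>Integrability on \<open>{t0..T}\<close> yields measurability of the cut-off
    function only, and \<open>N\<close> has to be measurable on the whole line.\<close>
  define g' where "g' \<tau> = indicator {t0..T} \<tau> *\<^sub>R g \<tau>" for \<tau>
  have g'[measurable]: "g' \<in> borel_measurable lebesgue"
    using borel_measurable_integrable[OF g[unfolded set_integrable_def]] by (simp add: g'_def[abs_def])
  have c'[measurable]: "c i \<in> borel_measurable lebesgue" for i
    using c[of i] by (intro measurable_completion) simp
  \<comment> \<open>Where no index qualifies, \<open>LEAST\<close> gives an unspecified one. Within
    \<open>{t0..T}\<close> this can happen only on a null set.\<close>
  define N where "N \<tau> = (LEAST i. dist (g' \<tau>) (c i \<tau>) < \<delta>)" for \<tau>
  have N[measurable]: "N \<in> measurable lebesgue (count_space UNIV)"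
    unfolding N_def by measurable
  define f where "f \<tau> = c (N \<tau>) \<tau>" for \<tau>
  have f[measurable]: "f \<in> borel_measurable lebesgue"
    unfolding f_def by (rule measurable_compose_countable[OF c' N])
  have s[measurable]: "(\<lambda>\<tau>. c (step_index a q \<tau>) \<tau>) \<in> borel_measurable lebesgue" for q
    using measurable_step_index by (intro measurable_compose_countable[OF c'] measurable_completion) simp
  have int_bound: "integrable lebesgue (\<lambda>\<tau>. indicator {a..b} \<tau> * C)"
    by (rule integrable_indicator_Icc_mult)
  have int_f: "set_integrable lebesgue {a..b} f"
    unfolding set_integrable_def
  proof (rule Bochner_Integration.integrable_bound[OF int_bound])
    show "AE \<tau> in lebesgue. norm (indicator {a..b} \<tau> *\<^sub>R f \<tau>) \<le> norm (indicator {a..b} \<tau> * C)"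
      using sub by (intro AE_I2) (auto split: split_indicator simp: f_def intro: order_trans[OF bound abs_ge_self])
  next
    show "(\<lambda>\<tau>. indicator {a..b} \<tau> *\<^sub>R f \<tau>) \<in> borel_measurable lebesgue"
      by (intro borel_measurable_scaleR borel_measurable_indicator f) simp
  qed
  have int_g: "set_integrable lebesgue {a..b} g"
    using set_integrable_subset[OF g _ sub] by simp
  have near: "AE \<tau> in lebesgue. \<tau> \<in> {a..b} \<longrightarrow> norm (g \<tau> - f \<tau>) \<le> \<delta>"
    using gH
  proof (rule AE_mp, intro AE_I2 impI)
    fix \<tau> assume "\<tau> \<in> {t0..T} \<longrightarrow> g \<tau> \<in> H \<tau>" "\<tau> \<in> {a..b}"
    then have \<tau>: "\<tau> \<in> {t0..T}" "g \<tau> \<in> closure (range (\<lambda>i. c i \<tau>))"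
      using sub dense[of \<tau>] by auto
    then obtain i where "dist (g' \<tau>) (c i \<tau>) < \<delta>"
      using \<open>0 < \<delta>\<close> by (auto simp: closure_approachable g'_def dist_commute)
    then have "dist (g' \<tau>) (c (N \<tau>) \<tau>) < \<delta>"
      unfolding N_def by (rule LeastI)
    then show "norm (g \<tau> - f \<tau>) \<le> \<delta>"
      using \<tau> by (simp add: f_def g'_def dist_norm)
  qed
  have "norm (x - set_lebesgue_integral lebesgue {a..b} f) =
      norm (\<integral>\<tau>. indicator {a..b} \<tau> *\<^sub>R (g \<tau> - f \<tau>) \<partial>lebesgue)"
    unfolding xg using set_integral_diff(2)[OF int_g int_f] by (simp add: set_lebesgue_integral_def)
  also have "\<dots> \<le> (\<integral>\<tau>. indicator {a..b} \<tau> * \<delta> \<partial>lebesgue)"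
  proof (rule order_trans[OF integral_norm_bound integral_mono_AE])
    show "integrable lebesgue (\<lambda>\<tau>. norm (indicator {a..b} \<tau> *\<^sub>R (g \<tau> - f \<tau>)))"
      using set_integral_diff(1)[OF int_g int_f] unfolding set_integrable_def by (rule integrable_norm)
    show "integrable lebesgue (\<lambda>\<tau>. indicator {a..b} \<tau> * \<delta>)"
      by (rule integrable_indicator_Icc_mult)
    show "AE \<tau> in lebesgue. norm (indicator {a..b} \<tau> *\<^sub>R (g \<tau> - f \<tau>)) \<le> indicator {a..b} \<tau> * \<delta>"
      using near by (rule AE_mp) (auto split: split_indicator)
  qed
  also have "\<dots> = measure lebesgue {a..b} * \<delta>"
    by simp
  also have "\<dots> \<le> \<bar>b - a\<bar> * \<delta>"
    using \<open>0 < \<delta>\<close> by (intro mult_right_mono) auto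
  also have "\<dots> < \<epsilon>"
    using \<epsilon>(1) by (simp add: \<delta>_def field_simps)
  finally have fU: "set_lebesgue_integral lebesgue {a..b} f \<in> U"
    using \<epsilon>(2) by (auto simp: dist_norm)
  obtain q where q: "AE \<tau> in lebesgue. \<tau> \<in> {a..b} \<longrightarrow> (\<forall>\<^sub>F k in sequentially. step_index a (q k) \<tau> = N \<tau>)"
    using step_index_eventually_eq[OF N] by blast
  have "(\<lambda>k. set_lebesgue_integral lebesgue {a..b} (\<lambda>\<tau>. c (step_index a (q k) \<tau>) \<tau>))
      \<longlonglongrightarrow> set_lebesgue_integral lebesgue {a..b} f"
    unfolding set_lebesgue_integral_def
  proof (rule integral_dominated_convergence[OF _ _ int_bound])
    show "AE \<tau> in lebesgue. (\<lambda>k. indicator {a..b} \<tau> *\<^sub>R c (step_index a (q k) \<tau>) \<tau>)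
        \<longlonglongrightarrow> indicator {a..b} \<tau> *\<^sub>R f \<tau>"
      using q
    proof (rule AE_mp, intro AE_I2 impI)
      fix \<tau> assume \<tau>: "\<tau> \<in> {a..b} \<longrightarrow> (\<forall>\<^sub>F k in sequentially. step_index a (q k) \<tau> = N \<tau>)"
      show "(\<lambda>k. indicator {a..b} \<tau> *\<^sub>R c (step_index a (q k) \<tau>) \<tau>) \<longlonglongrightarrow> indicator {a..b} \<tau> *\<^sub>R f \<tau>"
      proof (cases "\<tau> \<in> {a..b}")
        case True
        with \<tau> have "\<forall>\<^sub>F k in sequentially. step_index a (q k) \<tau> = N \<tau>"
          by blast
        then have "\<forall>\<^sub>F k in sequentially. indicator {a..b} \<tau> *\<^sub>R c (step_index a (q k) \<tau>) \<tau> = indicator {a..b} \<tau> *\<^sub>R f \<tau>"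
          by (rule eventually_mono) (simp add: f_def)
        then show ?thesis
          by (rule tendsto_eventually)
      qed simp
    qed
    show "AE \<tau> in lebesgue. norm (indicator {a..b} \<tau> *\<^sub>R c (step_index a (q k) \<tau>) \<tau>) \<le> indicator {a..b} \<tau> * C" for k
      using bound sub by (intro AE_I2) (auto split: split_indicator)
  next
    show "(\<lambda>\<tau>. indicator {a..b} \<tau> *\<^sub>R f \<tau>) \<in> borel_measurable lebesgue"
        "(\<lambda>\<tau>. indicator {a..b} \<tau> *\<^sub>R c (step_index a (q k) \<tau>) \<tau>) \<in> borel_measurable lebesgue" for k
      by (intro borel_measurable_scaleR borel_measurable_indicator f s; simp)+
  qed
  then have "\<forall>\<^sub>F k in sequentially. set_lebesgue_integral lebesgue {a..b} (\<lambda>\<tau>. c (step_index a (q k) \<tau>) \<tau>) \<in> U"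
    using U(1) fU by (rule topological_tendstoD)
  then show ?thesis
    using eventually_happens'[OF trivial_limit_sequentially] by fast
qed

text \<open>Joint measurability of \<open>G\<close> gives a Castaing representation on the product,
  hence jointly measurable integrands \<open>h q\<close>, whose integrals \<open>J q\<close> are
  measurable in \<open>\<omega>\<close>. Every \<open>J q \<omega>\<close> belongs to the Aumann
  integral (\<open>sel\<close>), and together they enter every open set that it meets
  (\<open>hit\<close>).\<close>

lemma set_valued_measurable_aumann_integral:
  fixes G :: "'w \<Rightarrow> real \<Rightarrow> 'x::{banach, second_countable_topology} set"
  assumes G: "set_valued_measurable (restrict_space (M \<Otimes>\<^sub>M borel) (space M \<times> {t0..T})) (\<lambda>(\<omega>, \<tau>). G \<omega> \<tau>)"
    and cl: "\<And>\<omega> \<tau>. \<omega> \<in> space M \<Longrightarrow> \<tau> \<in> {t0..T} \<Longrightarrow> closed (G \<omega> \<tau>)"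
    and ne: "\<And>\<omega> \<tau>. \<omega> \<in> space M \<Longrightarrow> \<tau> \<in> {t0..T} \<Longrightarrow> G \<omega> \<tau> \<noteq> {}"
    and K: "bounded K" "\<And>\<omega> \<tau>. \<omega> \<in> space M \<Longrightarrow> \<tau> \<in> {t0..T} \<Longrightarrow> G \<omega> \<tau> \<subseteq> K"
    and ab: "t0 \<le> a" "b \<le> T"
  shows "set_valued_measurable M (\<lambda>\<omega>. aumann_integral t0 T (G \<omega>) a b)"
  unfolding set_valued_measurable_def
proof (intro allI impI)
  fix U :: "'x set" assume U: "open U"
  define E where "E = restrict_space (M \<Otimes>\<^sub>M (borel :: real measure)) (space M \<times> {t0..T})"
  have spE: "space E = space M \<times> {t0..T}"
    by (auto simp: E_def space_restrict_space space_pair_measure)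
  have G': "set_valued_measurable E (\<lambda>e. G (fst e) (snd e))"
    using G by (simp add: E_def case_prod_unfold)
  have cl': "closed (G (fst e) (snd e))" and ne': "G (fst e) (snd e) \<noteq> {}" if "e \<in> space E" for e
    using that cl ne by (auto simp: spE)
  obtain c :: "nat \<Rightarrow> 'w \<times> real \<Rightarrow> 'x" where c: "\<And>i. c i \<in> borel_measurable E"
      and cG: "\<And>i e. e \<in> space E \<Longrightarrow> c i e \<in> G (fst e) (snd e)"
      and cd: "\<And>e. e \<in> space E \<Longrightarrow> G (fst e) (snd e) \<subseteq> closure (range (\<lambda>i. c i e))"
    by (rule castaing_representation[of E "\<lambda>e. G (fst e) (snd e)"]) (rule G', erule cl', erule ne', rule that)
  \<comment> \<open>Extension by zero from the strip to the whole product, where measurability of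
    parameter integrals applies.\<close>
  define c' where "c' i e = indicator (space M \<times> {t0..T}) e *\<^sub>R c i e" for i e
  have c'[measurable]: "c' i \<in> borel_measurable (M \<Otimes>\<^sub>M borel)" for i
    unfolding c'_def
    by (subst borel_measurable_restrict_space_iff[symmetric]) (use c in \<open>auto simp: E_def\<close>)
  have c'_eq: "c' i (\<omega>, \<tau>) = c i (\<omega>, \<tau>)" if "\<omega> \<in> space M" "\<tau> \<in> {t0..T}" for i \<omega> \<tau>
    using that by (simp add: c'_def)
  have c'G: "c' i (\<omega>, \<tau>) \<in> G \<omega> \<tau>" if "\<omega> \<in> space M" "\<tau> \<in> {t0..T}" for i \<omega> \<tau>
    using cG[of "(\<omega>, \<tau>)" i] that by (simp add: c'_eq spE)
  have c'd: "G \<omega> \<tau> \<subseteq> closure (range (\<lambda>i. c' i (\<omega>, \<tau>)))" if "\<omega> \<in> space M" "\<tau> \<in> {t0..T}" for \<omega> \<tau>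
    using cd[of "(\<omega>, \<tau>)"] that by (simp add: c'_eq spE)
  obtain C where C: "\<And>z. z \<in> K \<Longrightarrow> norm z \<le> C"
    using K(1) by (auto simp: bounded_iff)
  have c'b: "norm (c' i (\<omega>, \<tau>)) \<le> C" if "\<omega> \<in> space M" "\<tau> \<in> {t0..T}" for i \<omega> \<tau>
    using c'G[OF that] K(2)[OF that] C by blast
  define h where "h q e = c' (step_index a q (snd e)) e" for q and e :: "'w \<times> real"
  have h[measurable]: "h q \<in> borel_measurable (M \<Otimes>\<^sub>M borel)" for q
    unfolding h_def by (rule measurable_compose_countable[OF c']) measurable
  have h1[measurable]: "(\<lambda>\<tau>. h q (\<omega>, \<tau>)) \<in> borel_measurable borel" if "\<omega> \<in> space M" for q \<omega>
    using that by measurable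
  \<comment> \<open>Integration is against \<open>lborel\<close>, which fits the product with
    \<open>borel\<close>; for Borel integrands the completed measure gives the same value
    (\<open>J_eq\<close>).\<close>
  define J where "J q \<omega> = (\<integral>\<tau>. indicator {a..b} \<tau> *\<^sub>R h q (\<omega>, \<tau>) \<partial>lborel)" for q \<omega>
  have J[measurable]: "J q \<in> borel_measurable M" for q
    unfolding J_def by (rule lborel.borel_measurable_lebesgue_integral) measurable
  have J_eq: "set_lebesgue_integral lebesgue {a..b} (\<lambda>\<tau>. h q (\<omega>, \<tau>)) = J q \<omega>"
    if [measurable]: "\<omega> \<in> space M" for q \<omega>
    unfolding J_def set_lebesgue_integral_def by (rule integral_completion) measurable
  have sel: "J q \<omega> \<in> aumann_integral t0 T (G \<omega>) a b" if \<omega>[measurable]: "\<omega> \<in> space M" for q \<omega>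
  proof -
    have "set_integrable lebesgue {t0..T} (\<lambda>\<tau>. h q (\<omega>, \<tau>))"
      unfolding set_integrable_def
    proof (rule Bochner_Integration.integrable_bound)
      show "integrable lebesgue (\<lambda>\<tau>. indicator {t0..T} \<tau> * C)"
        by (rule integrable_indicator_Icc_mult)
      show "(\<lambda>\<tau>. indicator {t0..T} \<tau> *\<^sub>R h q (\<omega>, \<tau>)) \<in> borel_measurable lebesgue"
        by (intro measurable_completion) measurable
      show "AE \<tau> in lebesgue. norm (indicator {t0..T} \<tau> *\<^sub>R h q (\<omega>, \<tau>)) \<le> norm (indicator {t0..T} \<tau> * C)"
        using \<omega> by (intro AE_I2) (auto split: split_indicator simp: h_def intro: order_trans[OF c'b abs_ge_self])
    qed
    then show ?thesis
      unfolding aumann_integral_def J_eq[OF \<omega>, symmetric]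
      using c'G[OF \<omega>] by (intro CollectI exI[of _ "\<lambda>\<tau>. h q (\<omega>, \<tau>)"]) (auto simp: h_def)
  qed
  have hit: "\<exists>q. J q \<omega> \<in> U" if \<omega>: "\<omega> \<in> space M" "x \<in> aumann_integral t0 T (G \<omega>) a b" "x \<in> U" for \<omega> x
  proof -
    have "c' i \<in> borel_measurable (M \<Otimes>\<^sub>M borel)" for i
      by (rule c')
    then have "(\<lambda>\<tau>. c' i (\<omega>, \<tau>)) \<in> borel_measurable borel" for i
      using \<omega>(1) by measurable
    from aumann_integral_step_selection[of "\<lambda>i \<tau>. c' i (\<omega>, \<tau>)", OF this c'b c'd ab U \<omega>(3) \<omega>(2)]
    obtain q where "set_lebesgue_integral lebesgue {a..b} (\<lambda>\<tau>. c' (step_index a q \<tau>) (\<omega>, \<tau>)) \<in> U"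
      using \<omega>(1) by blast
    then have "J q \<omega> \<in> U"
      using J_eq[OF \<omega>(1), of q] by (simp add: h_def)
    then show ?thesis ..
  qed
  have "{\<omega> \<in> space M. aumann_integral t0 T (G \<omega>) a b \<inter> U \<noteq> {}} = (\<Union>q. {\<omega> \<in> space M. J q \<omega> \<in> U})"
  proof (intro equalityI subsetI)
    fix \<omega> assume "\<omega> \<in> {\<omega> \<in> space M. aumann_integral t0 T (G \<omega>) a b \<inter> U \<noteq> {}}"
    then obtain x where \<omega>: "\<omega> \<in> space M" and x: "x \<in> aumann_integral t0 T (G \<omega>) a b" "x \<in> U"
      by blast
    obtain q where "J q \<omega> \<in> U"
      using hit[OF \<omega> x] by (rule exE)
    with \<omega> show "\<omega> \<in> (\<Union>q. {\<omega> \<in> space M. J q \<omega> \<in> U})"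
      by (intro UN_I[of q]) simp_all
  next
    fix \<omega> assume "\<omega> \<in> (\<Union>q. {\<omega> \<in> space M. J q \<omega> \<in> U})"
    then obtain q where \<omega>: "\<omega> \<in> space M" and "J q \<omega> \<in> U"
      by (elim UN_E CollectE conjE)
    then have "J q \<omega> \<in> aumann_integral t0 T (G \<omega>) a b \<inter> U"
      using sel[OF \<omega>] by simp
    with \<omega> show "\<omega> \<in> {\<omega> \<in> space M. aumann_integral t0 T (G \<omega>) a b \<inter> U \<noteq> {}}"
      by auto
  qed
  also have "\<dots> \<in> sets M"
  proof (rule sets.countable_UN'')
    show "{\<omega> \<in> space M. J q \<omega> \<in> U} \<in> sets M" for q
      using measurable_sets[OF J borel_open[OF U], of q] by (simp add: vimage_def Int_def conj_commute)
  qed simp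
  finally show "{\<omega> \<in> space M. aumann_integral t0 T (G \<omega>) a b \<inter> U \<noteq> {}} \<in> sets M" .
qed

section \<open>Predictable sets and the product sigma-algebra\<close>

lemma (in filtered_complete_prob_space) sets_filtration_le:
  "t \<in> {t0..T} \<Longrightarrow> sets (F t) \<subseteq> sets M"
  using subalg[of t] by (simp add: subalgebra_def)

text \<open>The generators are rectangles with one side in \<open>M\<close> and the other a Borel
  subset of \<open>{t0..T}\<close>. This turns predictability of a growth process into the joint
  measurability used for its integral.\<close>

lemma (in filtered_complete_prob_space) sets_predictable_sigma_le:
  assumes "t0 \<le> T"
  shows "sets (predictable_sigma M F t0 T) \<subseteq> sets (restrict_space (M \<Otimes>\<^sub>M borel) (space M \<times> {t0..T}))"
proof -
  let ?E = "restrict_space (M \<Otimes>\<^sub>M borel) (space M \<times> {t0..T})"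
  let ?\<G> = "{A \<times> {t0} | A. A \<in> sets (F t0)} \<union>
      {A \<times> {s<..t} | A s t. t0 \<le> s \<and> s < t \<and> t \<le> T \<and> A \<in> sets (F s)}"
  have spE: "space ?E = space M \<times> {t0..T}"
    by (auto simp: space_restrict_space space_pair_measure)
  have rect: "A \<times> S \<in> sets ?E" if "A \<in> sets M" "S \<in> sets borel" "S \<subseteq> {t0..T}" for A S
    using that sets.sets_into_space[OF that(1)]
    by (subst sets_restrict_space_iff) auto
  have "A \<in> sets M" if "A \<in> sets (F s)" "s \<in> {t0..T}" for A s
    using that sets_filtration_le by blast
  then have gen: "?\<G> \<subseteq> sets ?E"
    using assms by (auto intro!: rect)
  then have "?\<G> \<subseteq> Pow (space M \<times> {t0..T})"
    using sets.space_closed[of ?E] unfolding spE by (rule order_trans)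
  then show ?thesis
    using sets.sigma_sets_subset[OF gen] unfolding predictable_sigma_def spE by simp
qed

section \<open>Measurability of the growth sums\<close>

lemma is_partition_mem:
  assumes "is_partition t0 t n p" "i \<le> n"
  shows "p i \<in> {t0..t}"
proof -
  have mono: "p i \<le> p j" if "i \<le> j" "j \<le> n" for i j
    using that
  proof (induction rule: dec_induct)
    case (step k)
    then show ?case
      using assms(1) unfolding is_partition_def
      by (meson Suc_leD less_eq_real_def less_le_trans lessI order_trans)
  qed simp
  show ?thesis
    using mono[of 0 i] mono[of i n] assms by (simp add: is_partition_def)
qed

text \<open>Treats both sums at once: they differ only in the lower limit of integration
  \<open>u i\<close>, which is \<open>p i\<close> for the lower and \<open>p (i - 1)\<close> for the
  upper sum.\<close>

lemma random_closed_set_growth_sum: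
  fixes B G :: "'w \<Rightarrow> real \<Rightarrow> 'x::{banach, second_countable_topology} set"
  assumes filt: "filtered_complete_prob_space M F t0 T"
    and B: "nucleation_process M F t0 T B" and G: "growth_process M F t0 T G"
    and t: "t \<in> {t0..T}" and p: "is_partition t0 t n p"
    and u: "\<And>i. i \<in> {1..n} \<Longrightarrow> t0 \<le> u i"
  shows "random_closed_set M (\<lambda>\<omega>. closed_minkowski_sum (B \<omega> t0) (aumann_integral t0 T (G \<omega>) t0 t) \<union>
     (\<Union>i\<in>{1..n}. closed_minkowski_sum (nucleation_increment (B \<omega>) p i)
                     (aumann_integral t0 T (G \<omega>) (u i) t)))"
proof -
  interpret filtered_complete_prob_space M F t0 T
    by (rule filt)
  have t0T: "t0 \<le> T"
    using t by auto
  obtain K where K: "bounded K" "\<And>\<omega> \<tau>. \<omega> \<in> space M \<Longrightarrow> \<tau> \<in> {t0..T} \<Longrightarrow> G \<omega> \<tau> \<subseteq> K"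
    using G unfolding growth_process_def by meson
  have G0: "closed (G \<omega> \<tau>)" "0 \<in> G \<omega> \<tau>" if "\<omega> \<in> space M" "\<tau> \<in> {t0..T}" for \<omega> \<tau>
    using G that by (auto simp: growth_process_def)
  have B0: "closed (B \<omega> s)" "B \<omega> s \<noteq> {}" if "\<omega> \<in> space M" "s \<in> {t0..T}" for \<omega> s
    using B that by (auto simp: nucleation_process_def)
  have "set_valued_measurable (restrict_space (M \<Otimes>\<^sub>M borel) (space M \<times> {t0..T})) (\<lambda>(\<omega>, \<tau>). G \<omega> \<tau>)"
  proof (rule set_valued_measurable_mono)
    show "set_valued_measurable (predictable_sigma M F t0 T) (\<lambda>(\<omega>, \<tau>). G \<omega> \<tau>)"
      using G by (simp add: growth_process_def)
    show "space (predictable_sigma M F t0 T) = space (restrict_space (M \<Otimes>\<^sub>M borel) (space M \<times> {t0..T}))"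
      by (auto simp: predictable_sigma_def space_measure_of_conv space_restrict_space space_pair_measure)
  qed (rule sets_predictable_sigma_le[OF t0T])
  then have A_meas: "set_valued_measurable M (\<lambda>\<omega>. aumann_integral t0 T (G \<omega>) a t)" if "t0 \<le> a" for a
  proof (rule set_valued_measurable_aumann_integral[where K = K])
    show "G \<omega> \<tau> \<noteq> {}" if "\<omega> \<in> space M" "\<tau> \<in> {t0..T}" for \<omega> \<tau>
      using G0(2)[OF that] by blast
  qed (rule that G0(1) K \<open>t \<in> {t0..T}\<close>[unfolded atLeastAtMost_iff, THEN conjunct2] | assumption)+
  have B_meas: "set_valued_measurable M (\<lambda>\<omega>. B \<omega> s)" if "s \<in> {t0..T}" for s
  proof (rule set_valued_measurable_mono)
    show "set_valued_measurable (F s) (\<lambda>\<omega>. B \<omega> s)"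
      using B that by (simp add: nucleation_process_def)
    show "space (F s) = space M" "sets (F s) \<subseteq> sets M"
      using subalg[OF that] by (simp_all add: subalgebra_def)
  qed
  have inc_meas: "set_valued_measurable M (\<lambda>\<omega>. nucleation_increment (B \<omega>) p i)" if i: "i \<in> {1..n}" for i
  proof -
    have pi: "p i \<in> {t0..T}" "p (i - 1) \<in> {t0..T}"
      using is_partition_mem[OF p, of i] is_partition_mem[OF p, of "i - 1"] i t by force+
    have "p (i - 1) < p (Suc (i - 1))"
      using p i by (auto simp: is_partition_def simp del: Suc_pred)
    then have "B \<omega> (p (i - 1)) \<subseteq> B \<omega> (p i)" if "\<omega> \<in> space M" for \<omega>
      using B that pi i by (simp add: nucleation_process_def)
    then show ?thesis
      unfolding nucleation_increment_def using B0(1) pi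
      by (intro set_valued_measurable_diff_interior B_meas) auto
  qed
  \<comment> \<open>The zero function is a selection. Increments of \<open>B\<close> may be empty,
    so non-emptiness of the union is drawn from its first term.\<close>
  have "0 \<in> aumann_integral t0 T (G \<omega>) t0 t" if "\<omega> \<in> space M" for \<omega>
    unfolding aumann_integral_def using G0(2)[OF that]
    by (intro CollectI exI[of _ "\<lambda>_. 0"]) (auto simp: set_lebesgue_integral_def set_integrable_def)
  then have ne: "closed_minkowski_sum (B \<omega> t0) (aumann_integral t0 T (G \<omega>) t0 t) \<noteq> {}"
    if "\<omega> \<in> space M" for \<omega>
    using B0(2)[OF that, of t0] that t0T by (auto simp: closed_minkowski_sum_def set_plus_def)
  show ?thesis
    unfolding random_closed_set_def
  proof (intro conjI ballI)
    show "set_valued_measurable M (\<lambda>\<omega>. closed_minkowski_sum (B \<omega> t0) (aumann_integral t0 T (G \<omega>) t0 t) \<union>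
       (\<Union>i\<in>{1..n}. closed_minkowski_sum (nucleation_increment (B \<omega>) p i)
                       (aumann_integral t0 T (G \<omega>) (u i) t)))"
      using t0T u by (intro set_valued_measurable_Un set_valued_measurable_UN
          set_valued_measurable_closed_minkowski_sum A_meas B_meas inc_meas) auto
    show "closed (closed_minkowski_sum (B \<omega> t0) (aumann_integral t0 T (G \<omega>) t0 t) \<union>
       (\<Union>i\<in>{1..n}. closed_minkowski_sum (nucleation_increment (B \<omega>) p i)
                       (aumann_integral t0 T (G \<omega>) (u i) t)))" for \<omega>
      unfolding closed_minkowski_sum_def by (intro closed_Un closed_UN ballI closed_closure finite_atLeastAtMost)
  qed (simp add: ne)
qed

theorem proposition4p1:
  fixes M :: "'w measure"
    and F :: "real \<Rightarrow> 'w measure"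
    and t0 T t :: real
    and B G :: "'w \<Rightarrow> real \<Rightarrow> 'x::{banach, second_countable_topology} set"
    and n :: nat
    and p :: "nat \<Rightarrow> real"
  assumes "reflexive_space TYPE('x)"
    and "separable_dual TYPE('x)"
    and "filtered_complete_prob_space M F t0 T"
    and "nucleation_process M F t0 T B"
    and "growth_process M F t0 T G"
    and "t \<in> {t0..T}"
    and "is_partition t0 t n p"
  shows "random_closed_set M (lower_growth_sum t0 T B G n p t) \<and>
         random_closed_set M (upper_growth_sum t0 T B G n p t)"
proof
  note growth_sum = random_closed_set_growth_sum[OF assms(3-7)]
  have p: "t0 \<le> p i" if "i \<le> n" for i
    using is_partition_mem[OF assms(7) that] by simp
  show "random_closed_set M (lower_growth_sum t0 T B G n p t)"
    unfolding lower_growth_sum_def[abs_def] by (rule growth_sum) (simp add: p)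
  show "random_closed_set M (upper_growth_sum t0 T B G n p t)"
    unfolding upper_growth_sum_def[abs_def] by (rule growth_sum) (rule p, auto)
qed

end
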